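(* For every integer $n\ge 0$, the following identity of polynomials in $x$ holds: \[ \sum_{k=0}^{n}E_{k}(x)E_{n-k}(x)=-\frac{8}{n+2}\sum_{k=0}^{n}\left(2^{k+1}k+2^{k}\right)\left\{\sum_{l=0}^{n}\sum_{\substack{0\le j\le l\\ j-k\equiv 0 \pmod 2}}\binom{n+2}{l}\binom{l}{j}E_{n-l+1}B_{l-j}\frac{j!\left(\frac{j+k+2}{2}\right)!}{\left(\frac{j-k}{2}\right)!\,(j+k+2)!}\right\}P_{k}(x). \]
   Context: $P_k(x)$ denotes the $k$-th Legendre polynomial, defined by $\frac{1}{\sqrt{1-2xt+t^2}}=\sum_{k\ge 0}P_k(x)t^k$ (equivalently $P_k(x)=\frac{1}{k!2^k}\frac{d^k}{dx^k}(x^2-1)^k$). The Euler polynomials $E_n(x)$ are defined by $\frac{2}{e^t+1}e^{xt}=\sum_{n\ge0}E_n(x)\frac{t^n}{n!}$, and $E_m:=E_m(0)$. The Bernoulli polynomials $B_n(x)$ are defined by $\frac{t}{e^t-1}e^{xt}=\sum_{n\ge0}B_n(x)\frac{t^n}{n!}$, and $B_m:=B_m(0)$. Convention: terms with $j<k$ are taken to be $0$, i.e. $1/m!=0$ for negative integers $m$. *)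

theory Defs
  imports
    "HOL-Computational_Algebra.Computational_Algebra"
    "HOL-Number_Theory.Cong"
begin

(* All generating functions are formal power series in t whose coefficients are real
   polynomials in x: fps_X is t, and fps_const [:0, 1:] is x. *)

definition fps_poly_lift :: "real fps \<Rightarrow> real poly fps" where
  "fps_poly_lift f = Abs_fps (\<lambda>n. [:fps_nth f n:])"

definition exp_xt :: "real poly fps" where
  "exp_xt = Abs_fps (\<lambda>n. smult (1 / fact n) ([:0, 1:] ^ n))"

definition euler_gf :: "real poly fps" where
  "euler_gf = fps_poly_lift (2 / (fps_exp 1 + 1)) * exp_xt"

definition euler_poly :: "nat \<Rightarrow> real poly" where
  "euler_poly n = smult (fact n) (fps_nth euler_gf n)"

definition euler_const :: "nat \<Rightarrow> real" where
  "euler_const m = poly (euler_poly m) 0"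

(* Division of real power series cancels the common factor t, so that
   t / (exp t - 1) is the usual power series with constant term 1. *)
definition bernoulli_gf :: "real poly fps" where
  "bernoulli_gf = fps_poly_lift (fps_X / (fps_exp 1 - 1)) * exp_xt"

definition bernoulli_poly :: "nat \<Rightarrow> real poly" where
  "bernoulli_poly n = smult (fact n) (fps_nth bernoulli_gf n)"

definition bernoulli_const :: "nat \<Rightarrow> real" where
  "bernoulli_const m = poly (bernoulli_poly m) 0"

(* 1 / sqrt (1 - 2 x t + t^2), as the binomial series (1 + u) powr (-1/2)
   at u = t^2 - 2 x t; see legendre_gf_square below. *)
definition legendre_gf :: "real poly fps" where
  "legendre_gf = fps_poly_lift (fps_binomial (- 1 / 2)) oo
     (fps_X ^ 2 - fps_const [:0, 2:] * fps_X)"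

definition legendre_poly :: "nat \<Rightarrow> real poly" where
  "legendre_poly k = fps_nth legendre_gf k"

definition inv_fact :: "int \<Rightarrow> real" where
  "inv_fact m = (if m < 0 then 0 else 1 / fact (nat m))"

lemma fps_poly_lift_mult: "fps_poly_lift (f * g) = fps_poly_lift f * fps_poly_lift g"
proof (rule fps_ext)
  fix n
  have "[:\<Sum>i\<in>A. h i:] = (\<Sum>i\<in>A. [:h i:])" for A and h :: "nat \<Rightarrow> real"
    by (auto simp: poly_eq_iff coeff_sum coeff_pCons split: nat.split)
  then show "fps_nth (fps_poly_lift (f * g)) n = fps_nth (fps_poly_lift f * fps_poly_lift g) n"
    by (simp add: fps_poly_lift_def fps_mult_nth mult.commute)
qed

lemma fps_poly_lift_add: "fps_poly_lift (f + g) = fps_poly_lift f + fps_poly_lift g"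
  by (simp add: fps_poly_lift_def fps_eq_iff)

lemma fps_poly_lift_1: "fps_poly_lift 1 = 1"
  by (auto simp: fps_poly_lift_def fps_eq_iff)

lemma fps_poly_lift_X: "fps_poly_lift fps_X = fps_X"
  by (auto simp: fps_poly_lift_def fps_eq_iff)

(* These two facts characterise 1 / sqrt (1 - 2 x t + t^2) as a power series in t. *)

lemma legendre_gf_0: "fps_nth legendre_gf 0 = 1"
  by (simp add: legendre_gf_def fps_poly_lift_def)

lemma legendre_gf_square:
  "legendre_gf ^ 2 * (1 - fps_const [:0, 2:] * fps_X + fps_X ^ 2) = 1"
proof -
  define u :: "real poly fps" where "u = fps_X ^ 2 - fps_const [:0, 2:] * fps_X"
  have u0: "fps_nth u 0 = 0" by (simp add: u_def)
  define b :: "real fps" where "b = fps_binomial (- 1 / 2)"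
  have "b ^ 2 * (1 + fps_X) = fps_binomial (- 1) * fps_binomial 1"
    by (simp add: b_def fps_binomial_power fps_binomial_1)
  also have "\<dots> = 1"
    by (simp flip: fps_binomial_add_mult)
  finally have "fps_poly_lift b ^ 2 * (1 + fps_X) = 1"
    by (metis fps_poly_lift_1 fps_poly_lift_X fps_poly_lift_add fps_poly_lift_mult power2_eq_square)
  then have "(fps_poly_lift b ^ 2 * (1 + fps_X)) oo u = 1"
    by simp
  then have "(fps_poly_lift b oo u) ^ 2 * (1 + u) = 1"
    by (simp add: fps_compose_mult_distrib [OF u0] fps_compose_add_distrib u0 power2_eq_square)
  then show ?thesis
    by (simp add: legendre_gf_def b_def u_def algebra_simps)
qed

lemma euler_gf_eq: "euler_gf * (fps_poly_lift (fps_exp 1) + 1) = fps_const 2 * exp_xt"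
proof -
  have "(2 / (fps_exp 1 + 1)) * (fps_exp 1 + 1) = (2 :: real fps)"
    by (rule dvd_div_mult_self) (simp add: unit_imp_dvd fps_is_unit_iff)
  then have "fps_poly_lift (2 / (fps_exp 1 + 1)) * (fps_poly_lift (fps_exp 1) + 1) = fps_const 2"
    by (simp flip: fps_poly_lift_1 fps_poly_lift_add fps_poly_lift_mult)
       (auto simp: fps_poly_lift_def fps_eq_iff fps_numeral_nth numeral_poly)
  then show ?thesis
    by (metis (no_types) euler_gf_def mult.assoc mult.commute)
qed

lemma bernoulli_gf_eq: "bernoulli_gf * (fps_poly_lift (fps_exp 1) - 1) = fps_X * exp_xt"
proof -
  have "(fps_exp 1 - 1 :: real fps) dvd fps_X"
  proof -
    have "fps_exp 1 - 1 \<noteq> (0 :: real fps)" by (auto simp: fps_eq_iff intro!: exI[of _ 1])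
    moreover have "subdegree (fps_exp 1 - 1 :: real fps) = 1"
      by (rule subdegreeI) auto
    ultimately show ?thesis by (simp add: fps_dvd_iff)
  qed
  then have "fps_X / (fps_exp 1 - 1) * (fps_exp 1 - 1) = (fps_X :: real fps)"
    by (rule dvd_div_mult_self)
  moreover have "fps_poly_lift (fps_exp 1 - 1) = fps_poly_lift (fps_exp 1) - 1"
    by (auto simp: fps_poly_lift_def fps_eq_iff)
  ultimately have "fps_poly_lift (fps_X / (fps_exp 1 - 1)) * (fps_poly_lift (fps_exp 1) - 1) = fps_X"
    by (metis fps_poly_lift_X fps_poly_lift_mult)
  then show ?thesis
    by (metis (no_types) bernoulli_gf_def mult.assoc mult.commute)
qed

end

theory Submission
  imports Defs
begin

text \<open>
  Write $S_n$ for the left-hand side. Both $S_n$ and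
  $R_n = -\frac{4}{n+2} \sum_l {n+2 \choose l} E_{n-l+1} B_l(x)$ satisfy $p_{n+1}' = (n+2) p_n$ and
  $p_{n+1}(1) - p_{n+1}(0) = -4 E_{n+1}$, the latter because $E_k(1) = 2 [k = 0] - E_k$ and
  $B_l(1) - B_l(0) = [l = 1]$. By induction $S_n - R_n$ is a constant $c$, and the increment of
  $S_{n+1} - R_{n+1}$ over $[0, 1]$ is $(n+2) c = 0$; hence $S_n = R_n$. It remains to expand
  $B_l(x)$ in powers of $x$ and each power in Legendre polynomials; the coefficients of the latter
  expansion are found from Bonnet's recurrence $(2k+1) x P_k = (k+1) P_{k+1} + k P_{k-1}$.
\<close>

section \<open>Appell sequences, with the Euler and Bernoulli polynomials as instances\<close>

lemma smult_sum_right: "smult c (\<Sum>i\<in>A. f i) = (\<Sum>i\<in>A. smult c (f i))"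
  by (induction A rule: infinite_finite_induct) (simp_all add: smult_add_right)

lemma pderiv_sum: "pderiv (\<Sum>i\<in>A. f i) = (\<Sum>i\<in>A. pderiv (f i :: real poly))"
  by (induction A rule: infinite_finite_induct) (simp_all add: pderiv_add)

text \<open>The polynomials with exponential generating function a(t) exp(xt). Treating both
  families as instances means that the derivative rule, the expansion in powers of x and the values
  at 0 and 1 are proved once.\<close>

definition appell :: "real fps \<Rightarrow> nat \<Rightarrow> real poly" where
  "appell a n = smult (fact n) (fps_nth (fps_poly_lift a * exp_xt) n)"

lemma euler_poly_appell: "euler_poly = appell (2 / (fps_exp 1 + 1))"
  by (simp add: fun_eq_iff euler_poly_def euler_gf_def appell_def)

lemma bernoulli_poly_appell: "bernoulli_poly = appell (fps_X / (fps_exp 1 - 1))"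
  by (simp add: fun_eq_iff bernoulli_poly_def bernoulli_gf_def appell_def)

lemma appell_eq_sum:
  "appell a n = (\<Sum>j\<le>n. smult (real (n choose j) * (fact (n - j) * fps_nth a (n - j))) ([:0, 1:] ^ j))"
proof -
  have "appell a n = (\<Sum>i=0..n. smult (fact n * (fps_nth a i / fact (n - i))) ([:0, 1:] ^ (n - i)))"
    by (simp add: appell_def fps_mult_nth fps_poly_lift_def exp_xt_def smult_sum_right)
  also have "\<dots> = (\<Sum>j\<le>n. smult (fact n * (fps_nth a (n - j) / fact j)) ([:0, 1:] ^ j))"
    by (rule sum.reindex_bij_witness[of _ "\<lambda>j. n - j" "\<lambda>j. n - j"]) auto
  also have "\<dots> = (\<Sum>j\<le>n. smult (real (n choose j) * (fact (n - j) * fps_nth a (n - j))) ([:0, 1:] ^ j))"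
    by (intro sum.cong refl) (simp add: binomial_fact)
  finally show ?thesis .
qed

lemma poly_appell_0: "poly (appell a n) 0 = fact n * fps_nth a n"
  by (simp add: appell_eq_sum poly_sum power_0_left sum.delta if_distrib cong: if_cong)

lemma appell_expansion:
  "appell a n = (\<Sum>j\<le>n. smult (real (n choose j) * poly (appell a (n - j)) 0) ([:0, 1:] ^ j))"
  unfolding poly_appell_0 by (rule appell_eq_sum)

text \<open>At x = 1 the factor \<open>exp_xt\<close> becomes exp(t), so endpoint values turn into
  coefficients of a real power series.\<close>

lemma poly_appell_1: "poly (appell a n) 1 = fact n * fps_nth (a * fps_exp 1) n"
  by (simp add: appell_def fps_mult_nth fps_poly_lift_def exp_xt_def poly_sum sum_distrib_left)

lemma pderiv_appell_0: "pderiv (appell a 0) = 0"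
  by (simp add: appell_eq_sum)

lemma pderiv_appell_Suc: "pderiv (appell a (Suc n)) = smult (real (Suc n)) (appell a n)"
proof -
  have d: "pderiv ([:0, 1:] ^ Suc j) = smult (real (Suc j)) ([:0, 1:] ^ j :: real poly)" for j
    unfolding pderiv_power_Suc by (simp add: pderiv_pCons)
  have c: "real (Suc n choose Suc j) * real (Suc j) = real (Suc n) * real (n choose j)" for j
    by (metis Suc_times_binomial_eq of_nat_mult)
  have "pderiv (appell a (Suc n)) =
      (\<Sum>j\<le>n. smult (real (Suc n choose Suc j) * (fact (n - j) * fps_nth a (n - j))) (pderiv ([:0, 1:] ^ Suc j)))"
    unfolding appell_eq_sum[of a "Suc n"] sum.atMost_Suc_shift
    by (simp add: pderiv_add pderiv_sum pderiv_smult del: power_Suc binomial_Suc_Suc)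
  also have "\<dots> = (\<Sum>j\<le>n. smult (real (Suc n choose Suc j) * real (Suc j) * (fact (n - j) * fps_nth a (n - j))) ([:0, 1:] ^ j))"
    unfolding d by (simp add: mult_ac del: power_Suc binomial_Suc_Suc)
  also have "\<dots> = smult (real (Suc n)) (appell a n)"
    unfolding c appell_eq_sum by (simp only: smult_sum_right smult_smult mult.assoc)
  finally show ?thesis .
qed

lemma poly_euler_1:
  "poly (euler_poly n) 1 = (if n = 0 then 2 else 0) - poly (euler_poly n) 0"
proof -
  define a where "a = (2 / (fps_exp 1 + 1) :: real fps)"
  have "a * (fps_exp 1 + 1) = 2"
    unfolding a_def by (rule dvd_div_mult_self) (simp add: unit_imp_dvd fps_is_unit_iff)
  \<comment> \<open>The coefficient of t^n in a(t) (exp(t) + 1) = 2 relates the values at 1 and at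
    0.\<close>
  then have "fps_nth (a * fps_exp 1) n + fps_nth a n = fps_nth 2 n"
    by (metis (no_types) distrib_left fps_add_nth mult.right_neutral)
  then show ?thesis
    unfolding euler_poly_appell a_def[symmetric] poly_appell_0 poly_appell_1
    by (cases "n = 0") (auto simp: fps_numeral_nth simp flip: distrib_left eq_diff_eq)
qed

lemma poly_bernoulli_1:
  "poly (bernoulli_poly n) 1 = poly (bernoulli_poly n) 0 + (if n = 1 then 1 else 0)"
proof -
  define a where "a = (fps_X / (fps_exp 1 - 1) :: real fps)"
  \<comment> \<open>exp(t) - 1 has order 1 and hence divides t, so the quotient \<open>a\<close>
    satisfies a(t) (exp(t) - 1) = t exactly.\<close>
  have "fps_exp 1 - 1 \<noteq> (0 :: real fps)" by (auto simp: fps_eq_iff intro!: exI[of _ 1])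
  moreover have "subdegree (fps_exp 1 - 1 :: real fps) = 1"
    by (rule subdegreeI) auto
  ultimately have "(fps_exp 1 - 1 :: real fps) dvd fps_X"
    by (simp add: fps_dvd_iff)
  then have "a * (fps_exp 1 - 1) = fps_X"
    unfolding a_def by (rule dvd_div_mult_self)
  then have "fps_nth (a * fps_exp 1) n - fps_nth a n = fps_nth fps_X n"
    by (metis (no_types) right_diff_distrib fps_sub_nth mult.right_neutral)
  then have "fps_nth (a * fps_exp 1) n = fps_nth a n + (if n = 1 then 1 else 0)"
    by (simp add: diff_eq_eq)
  then show ?thesis
    unfolding bernoulli_poly_appell a_def[symmetric] poly_appell_0 poly_appell_1
    by (simp add: distrib_left)
qed

section \<open>The Euler convolution as a combination of Bernoulli polynomials\<close>

definition euler_conv :: "nat \<Rightarrow> real poly" where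
  "euler_conv n = (\<Sum>k\<le>n. euler_poly k * euler_poly (n - k))"

definition bernoulli_side :: "nat \<Rightarrow> real poly" where
  "bernoulli_side n = smult (- 4 / (real n + 2))
     (\<Sum>l\<le>n. smult (real ((n + 2) choose l) * euler_const (n - l + 1)) (bernoulli_poly l))"

lemma pderiv_euler_conv_Suc:
  "pderiv (euler_conv (Suc n)) = smult (real n + 2) (euler_conv n)"
proof -
  let ?E = euler_poly
  have d: "pderiv (?E (Suc k)) = smult (real (Suc k)) (?E k)" and d0: "pderiv (?E 0) = 0" for k
    unfolding euler_poly_appell by (rule pderiv_appell_Suc pderiv_appell_0)+
  have "pderiv (euler_conv (Suc n)) =
      (\<Sum>k\<le>Suc n. ?E k * pderiv (?E (Suc n - k))) + (\<Sum>k\<le>Suc n. pderiv (?E k) * ?E (Suc n - k))"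
    by (simp add: euler_conv_def pderiv_sum pderiv_mult sum.distrib mult.commute add.commute
          del: sum.atMost_Suc)
  also have "(\<Sum>k\<le>Suc n. ?E k * pderiv (?E (Suc n - k))) =
      (\<Sum>k\<le>n. smult (real (n - k) + 1) (?E k * ?E (n - k)))"
    by (simp add: d0 Suc_diff_le d add.commute)
  also have "(\<Sum>k\<le>Suc n. pderiv (?E k) * ?E (Suc n - k)) =
      (\<Sum>k\<le>n. smult (real k + 1) (?E k * ?E (n - k)))"
    unfolding sum.atMost_Suc_shift by (simp add: d0 d add.commute)
  \<comment> \<open>The weights left by the two halves of the product rule add up to a constant: (n
    - k + 1) + (k + 1) = n + 2.\<close>
  also have "(\<Sum>k\<le>n. smult (real (n - k) + 1) (?E k * ?E (n - k))) + \<dots> =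
      (\<Sum>k\<le>n. smult (real n + 2) (?E k * ?E (n - k)))"
    unfolding sum.distrib[symmetric] smult_add_left[symmetric]
    by (intro sum.cong refl) (simp add: of_nat_diff)
  finally show ?thesis by (simp add: euler_conv_def smult_sum_right)
qed

lemma pderiv_bernoulli_side_Suc:
  "pderiv (bernoulli_side (Suc n)) = smult (real n + 2) (bernoulli_side n)"
proof -
  let ?B = bernoulli_poly
  have d: "pderiv (?B (Suc k)) = smult (real (Suc k)) (?B k)" and d0: "pderiv (?B 0) = 0" for k
    unfolding bernoulli_poly_appell by (rule pderiv_appell_Suc pderiv_appell_0)+
  \<comment> \<open>Absorption produces a factor n + 3, which cancels the denominator of
    \<open>bernoulli_side (Suc n)\<close>.\<close>
  have c: "real (Suc (n + 2) choose Suc l) * real (Suc l) = (real n + 3) * real ((n + 2) choose l)" for l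
    using Suc_times_binomial_eq[of "n + 2" l, THEN arg_cong[where f = real]]
    by (simp del: binomial_Suc_Suc add: algebra_simps)
  have "pderiv (bernoulli_side (Suc n)) = smult (- 4 / (real n + 3))
      (\<Sum>l\<le>n. smult (real (Suc (n + 2) choose Suc l) * real (Suc l) * euler_const (n - l + 1)) (?B l))"
    unfolding bernoulli_side_def sum.atMost_Suc_shift
    by (simp add: pderiv_minus pderiv_add pderiv_sum pderiv_smult d d0 mult_ac add_ac del: binomial_Suc_Suc)
  also have "\<dots> = smult (real n + 2) (bernoulli_side n)"
    unfolding c bernoulli_side_def by (simp add: smult_sum_right mult_ac)
  finally show ?thesis .
qed

lemma euler_conv_increment:
  "poly (euler_conv (Suc n)) 1 - poly (euler_conv (Suc n)) 0 = - 4 * euler_const (Suc n)"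
proof -
  define e where "e k = poly (euler_poly k) 0" for k
  \<comment> \<open>E_0 is constant, so the reflection E_0(1) = 2 - E_0(0) determines it.\<close>
  have e0: "e 0 = 1"
    using poly_euler_1[of 0] by (simp add: e_def euler_poly_appell appell_eq_sum)
  have "poly (euler_conv (Suc n)) 1 - poly (euler_conv (Suc n)) 0 =
      (\<Sum>k\<le>Suc n. ((if k = 0 then 2 else 0) - e k) * ((if Suc n - k = 0 then 2 else 0) - e (Suc n - k))
        - e k * e (Suc n - k))"
    unfolding euler_conv_def poly_sum poly_mult poly_euler_1 e_def sum_subtractf ..
  \<comment> \<open>The products of the values at 0 cancel, and the two corrections 2 never occur
    for the same k because the index n + 1 is positive. Each end of the sum contributes -2
    E_{n+1}.\<close>
  also have "\<dots> = (\<Sum>k\<le>Suc n. (if k = 0 then - 2 * e (Suc n) else 0)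
        + (if k = Suc n then - 2 * e (Suc n) else 0))"
    by (intro sum.cong refl) (auto simp: e0)
  also have "\<dots> = - 4 * e (Suc n)"
    by (simp only: sum.distrib sum.delta finite_atMost) simp
  finally show ?thesis by (simp add: e_def euler_const_def)
qed

lemma bernoulli_side_increment:
  "poly (bernoulli_side (Suc n)) 1 - poly (bernoulli_side (Suc n)) 0 = - 4 * euler_const (Suc n)"
proof -
  let ?c = "\<lambda>l. real ((Suc n + 2) choose l) * euler_const (Suc n - l + 1)"
  have "poly (bernoulli_side (Suc n)) 1 - poly (bernoulli_side (Suc n)) 0 =
      - 4 / (real (Suc n) + 2) * (\<Sum>l\<le>Suc n. ?c l * poly (bernoulli_poly l) 1 - ?c l * poly (bernoulli_poly l) 0)"
    unfolding bernoulli_side_def poly_sum poly_smult sum_subtractf right_diff_distrib ..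
  \<comment> \<open>Only B_1 changes between 0 and 1; its binomial coefficient n + 3 cancels the
    prefactor.\<close>
  also have "(\<Sum>l\<le>Suc n. ?c l * poly (bernoulli_poly l) 1 - ?c l * poly (bernoulli_poly l) 0)
      = (\<Sum>l\<le>Suc n. if l = 1 then ?c l else 0)"
    by (intro sum.cong refl) (simp add: poly_bernoulli_1 algebra_simps)
  also have "\<dots> = (real (Suc n) + 2) * euler_const (Suc n)"
    by (simp only: sum.delta finite_atMost) simp
  finally show ?thesis by simp
qed

lemma euler_conv_eq_bernoulli_side: "euler_conv n = bernoulli_side n"
proof (induction n rule: nat_less_induct)
  case (1 n)
  define D where "D k = euler_conv k - bernoulli_side k" for k
  have dD: "pderiv (D (Suc k)) = smult (real k + 2) (D k)" for k
    by (simp add: D_def pderiv_diff pderiv_euler_conv_Suc pderiv_bernoulli_side_Suc smult_diff_right)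
  have "pderiv (D n) = 0"
  proof (cases n)
    case 0
    have "pderiv (euler_poly 0) = 0" "pderiv (bernoulli_poly 0) = 0"
      unfolding euler_poly_appell bernoulli_poly_appell by (rule pderiv_appell_0)+
    with 0 show ?thesis
      by (simp add: D_def euler_conv_def bernoulli_side_def pderiv_add pderiv_diff pderiv_mult pderiv_smult)
  next
    case (Suc m)
    with 1 have "D m = 0" by (simp add: D_def)
    with dD[of m] Suc show ?thesis by simp
  qed
  then obtain c where c: "D n = [:c:]"
    by (metis degree_eq_zeroE pderiv_eq_0_iff)
  \<comment> \<open>The derivative of \<open>D (Suc n)\<close> is the constant (n + 2) c, so
    removing the linear term leaves a constant polynomial.\<close>
  define L where "L = D (Suc n) - [:0, (real n + 2) * c:]"
  have "pderiv L = 0"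
    by (simp add: L_def pderiv_diff dD c pderiv_pCons)
  then obtain d where "L = [:d:]"
    by (metis degree_eq_zeroE pderiv_eq_0_iff)
  then have "poly L 1 = poly L 0" by simp
  moreover have "poly (D (Suc n)) 1 = poly (D (Suc n)) 0"
    using euler_conv_increment[of n] bernoulli_side_increment[of n] by (simp add: D_def)
  ultimately have "(real n + 2) * c = 0" by (simp add: L_def)
  then have "c = 0" by (simp add: add_nonneg_eq_0_iff)
  with c show ?case by (simp add: D_def)
qed

section \<open>Bonnet's recurrence and the Legendre expansion of monomials\<close>

lemma legendre_gf_deriv:
  "fps_deriv legendre_gf * (1 - fps_const [:0, 2:] * fps_X + fps_X ^ 2) =
     legendre_gf * (fps_const [:0, 1:] - fps_X)"
proof -
  define G where "G = legendre_gf"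
  define D :: "real poly fps" where "D = 1 - fps_const [:0, 2:] * fps_X + fps_X ^ 2"
  have 2: "fps_const [:0, 2:] = 2 * fps_const [:0, 1 :: real:]"
    by (auto simp: fps_eq_iff fps_numeral_fps_const numeral_poly)
  have dD: "fps_deriv D = 2 * (fps_X - fps_const [:0, 1:])"
    by (simp add: D_def fps_deriv_power 2 right_diff_distrib)
  have GD: "G * (G * D) = 1"
    using legendre_gf_square by (simp add: G_def D_def power2_eq_square mult.assoc)
  then have G0: "G \<noteq> 0" by auto
  \<comment> \<open>Differentiating G^2 D = 1 gives 2 G (G' D - G (x - t)) = 0; power series over
    the real polynomials form an integral domain, so 2 G can be cancelled.\<close>
  have "fps_deriv (G * (G * D)) = 0" by (simp add: GD)
  then have "(2 * G) * (fps_deriv G * D - G * (fps_const [:0, 1:] - fps_X)) = 0"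
    by (simp add: dD algebra_simps)
  with G0 show ?thesis by (simp add: G_def D_def)
qed

lemma legendre_recurrence:
  "smult (2 * real k + 1) ([:0, 1:] * legendre_poly k) =
     smult (real k + 1) (legendre_poly (k + 1)) + smult (real k) (legendre_poly (k - 1))"
proof -
  define x where "x = [:0, 1 :: real:]"
  have x2: "[:0, 2:] = smult 2 x" by (simp add: x_def)
  have "fps_deriv legendre_gf - fps_const (smult 2 x) * (fps_X * fps_deriv legendre_gf)
      + fps_X * (fps_X * fps_deriv legendre_gf)
      = fps_const x * legendre_gf - fps_X * legendre_gf"
    using legendre_gf_deriv by (simp add: x2 algebra_simps power2_eq_square flip: x_def)
  \<comment> \<open>Compare coefficients of t^k. At k = 0 the truncated index k - 1 is harmless,
    since its term carries the factor k.\<close>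
  from arg_cong[OF this, where f = "\<lambda>f. fps_nth f k"] show ?thesis
    unfolding legendre_poly_def x_def[symmetric]
    by (cases k; cases "k - 1")
       (simp_all add: of_nat_poly smult_add_left smult_add_right poly_eq_iff numeral_poly algebra_simps)
qed

text \<open>This is half the integral of x^j P_k(x) over [-1, 1]. The coefficient of P_k in x^j is
  2k + 1 times it; leaving that factor out gives the recurrence below the shape of Bonnet's.\<close>

definition monomial_coeff :: "nat \<Rightarrow> nat \<Rightarrow> real" where
  "monomial_coeff j k = (if even (j + k) then
     2 ^ (k + 1) * fact j * fact ((j + k + 2) div 2) * inv_fact ((int j - int k) div 2) / fact (j + k + 2)
     else 0)"

lemma monomial_coeff_eq_0: "j < k \<Longrightarrow> monomial_coeff j k = 0"
  by (simp add: monomial_coeff_def inv_fact_def)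

lemma monomial_coeff_add:
  "monomial_coeff (k + 2 * m) k =
     2 ^ (k + 1) * fact (k + 2 * m) * fact (k + m + 1) / (fact m * fact (2 * (k + m + 1)))"
proof -
  have "(k + 2 * m + k + 2) div 2 = k + m + 1" "k + 2 * m + k + 2 = 2 * (k + m + 1)"
    "(int (k + 2 * m) - int k) div 2 = int m" by auto
  then show ?thesis unfolding monomial_coeff_def by (simp add: inv_fact_def)
qed

text \<open>Bonnet's recurrence integrated against x^j predicts this relation; here it is checked
  from the closed form.\<close>

lemma monomial_coeff_recurrence:
  "(2 * real k + 1) * monomial_coeff (Suc j) k =
     real k * monomial_coeff j (k - 1) + (real k + 1) * monomial_coeff j (k + 1)"
proof (cases "even (Suc j + k) \<and> k \<le> Suc j")
  case False
  then show ?thesis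
    \<comment> \<open>With the wrong parity, or with k > j + 1, every term vanishes.\<close>
    by (cases k) (auto simp: monomial_coeff_def inv_fact_def)
next
  case True
  then have "even (Suc j - k)" by simp
  then obtain m where "Suc j - k = 2 * m" by (rule evenE)
  with True have j: "Suc j = k + 2 * m" by linarith
  define N where "N = k + m"
  \<comment> \<open>For k > 0 this is \<open>monomial_coeff j (k - 1)\<close>. Times 2N + 1, the
    other two coefficients become (k + 2m) c and 2m c, so the claim reduces to (2k + 1)(k + 2m) =
    (2N + 1) k + 2m (k + 1).\<close>
  define c :: real where "c = 2 ^ k * fact j * fact N / (fact m * fact (2 * N))"
  have N: "real N = real k + real m" by (simp add: N_def)
  have nz: "2 * real N + 1 \<noteq> 0" by linarith
  have "fact (2 * (N + 1)) = 2 * (real N + 1) * (2 * real N + 1) * fact (2 * N)"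
    "fact (N + 1) = (real N + 1) * fact N"
    by (simp_all add: algebra_simps)
  \<comment> \<open>Used with M = N + 1, L = 2N + 1, F = (2N)! and G = N!.\<close>
  moreover have "2 * M * L * F \<noteq> 0 \<Longrightarrow> L * (M * G / (2 * M * L * F)) = G / (2 * F)" for F G L M :: real
    by simp
  moreover have "2 * (real N + 1) * (2 * real N + 1) * fact (2 * N) \<noteq> 0"
    using nz by (simp add: add_nonneg_eq_0_iff)
  ultimately have ratio: "(2 * real N + 1) * (fact (N + 1) / fact (2 * (N + 1))) = fact N / (2 * fact (2 * N))"
    by presburger
  have "fact (k + 2 * m) = (real k + 2 * real m) * fact j"
    unfolding j[symmetric] fact_Suc using arg_cong[OF j, of real] by simp
  then have "monomial_coeff (Suc j) k = 2 ^ (k + 1) * ((real k + 2 * real m) * fact j) * fact (N + 1)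
      / (fact m * fact (2 * (N + 1)))"
    unfolding j monomial_coeff_add N_def by simp
  then have "(2 * real N + 1) * monomial_coeff (Suc j) k =
      2 ^ (k + 1) * ((real k + 2 * real m) * fact j) / fact m *
      ((2 * real N + 1) * (fact (N + 1) / fact (2 * (N + 1))))"
    by simp
  also have "\<dots> = (real k + 2 * real m) * c"
    unfolding ratio c_def by simp
  finally have A: "(2 * real N + 1) * monomial_coeff (Suc j) k = (real k + 2 * real m) * c" .
  have B: "real k * monomial_coeff j (k - 1) = real k * c"
  proof (cases k)
    case (Suc i)
    with j have "j = i + 2 * m" by simp
    with Suc show ?thesis by (simp add: monomial_coeff_add c_def N_def del: fact_Suc)
  qed simp
  have C: "(2 * real N + 1) * monomial_coeff j (k + 1) = 2 * real m * c"
  proof (cases m)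
    case 0
    with j show ?thesis by (simp add: monomial_coeff_eq_0)
  next
    case (Suc p)
    with j have "j = (k + 1) + 2 * p" by simp
    moreover have "k + 1 + p = N" using Suc by (simp add: N_def)
    ultimately have "monomial_coeff j (k + 1) = 2 ^ (k + 2) * fact j * fact (N + 1) / (fact p * fact (2 * (N + 1)))"
      using monomial_coeff_add[of "k + 1" p] by simp
    moreover have fm: "fact m = real m * fact p" and m: "real m \<noteq> 0" by (simp_all add: Suc)
    ultimately have "(2 * real N + 1) * monomial_coeff j (k + 1) =
        2 ^ (k + 2) * fact j / fact p * ((2 * real N + 1) * (fact (N + 1) / fact (2 * (N + 1))))"
      by simp
    also have "\<dots> = 2 * real m * c"
      unfolding ratio c_def fm using m by simp
    finally show ?thesis .
  qed
  have "(2 * real N + 1) * ((2 * real k + 1) * monomial_coeff (Suc j) k) =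
      (2 * real k + 1) * ((real k + 2 * real m) * c)"
    using A by (metis mult.left_commute)
  also have "\<dots> = (2 * real N + 1) * (real k * c) + (real k + 1) * (2 * real m * c)"
    by (simp add: N algebra_simps)
  also have "\<dots> = (2 * real N + 1) *
      (real k * monomial_coeff j (k - 1) + (real k + 1) * monomial_coeff j (k + 1))"
    unfolding B[symmetric] C[symmetric] by (simp add: algebra_simps)
  finally show ?thesis using nz by (metis mult_left_cancel)
qed

lemma monomial_legendre:
  "[:0, 1:] ^ j = (\<Sum>k\<le>j. smult ((2 * real k + 1) * monomial_coeff j k) (legendre_poly k))"
proof (induction j)
  case 0
  then show ?case
    by (simp add: monomial_coeff_def inv_fact_def legendre_poly_def legendre_gf_0)
next
  case (Suc j)
  let ?b = monomial_coeff and ?P = legendre_poly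
  have "[:0, 1:] ^ Suc j = (\<Sum>k\<le>j. smult (?b j k) (smult (2 * real k + 1) ([:0, 1:] * ?P k)))"
    unfolding power_Suc Suc by (simp only: sum_distrib_left smult_smult mult_smult_right mult.commute)
  also have "\<dots> = (\<Sum>k\<le>j. smult ((real k + 1) * ?b j k) (?P (k + 1))) +
      (\<Sum>k\<le>j. smult (real k * ?b j k) (?P (k - 1)))"
    unfolding legendre_recurrence by (simp add: smult_add_right sum.distrib mult.commute)
  also have "(\<Sum>k\<le>j. smult ((real k + 1) * ?b j k) (?P (k + 1))) =
      (\<Sum>k\<le>Suc j. smult (real k * ?b j (k - 1)) (?P k))"
    unfolding sum.atMost_Suc_shift by (simp add: add.commute)
  \<comment> \<open>The two added terms vanish because there k > j. Shifting down then drops only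
    the term k = 0, which has factor 0, and both sums run up to j + 1.\<close>
  also have "(\<Sum>k\<le>j. smult (real k * ?b j k) (?P (k - 1))) =
      (\<Sum>k\<le>Suc (Suc j). smult (real k * ?b j k) (?P (k - 1)))"
    by (simp add: monomial_coeff_eq_0)
  also have "\<dots> = (\<Sum>k\<le>Suc j. smult ((real k + 1) * ?b j (k + 1)) (?P k))"
    unfolding sum.atMost_Suc_shift[of _ "Suc j"] by (simp add: add.commute)
  also have "(\<Sum>k\<le>Suc j. smult (real k * ?b j (k - 1)) (?P k)) + \<dots> =
      (\<Sum>k\<le>Suc j. smult ((2 * real k + 1) * ?b (Suc j) k) (?P k))"
    unfolding monomial_coeff_recurrence smult_add_left sum.distrib ..
  finally show ?case .
qed

section \<open>Assembly of the Legendre expansion\<close>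

theorem theorem5:
  fixes n :: nat
  shows "(\<Sum>k=0..n. euler_poly k * euler_poly (n - k)) =
    smult (- 8 / (real n + 2))
      (\<Sum>k=0..n.
        smult
          ((2 ^ (k + 1) * real k + 2 ^ k) *
           (\<Sum>l=0..n. \<Sum>j | j \<le> l \<and> [int j - int k = 0] (mod 2).
              real ((n + 2) choose l) * real (l choose j) *
              euler_const (n - l + 1) * bernoulli_const (l - j) *
              (fact j * fact ((j + k + 2) div 2) * inv_fact ((int j - int k) div 2)
                / fact (j + k + 2))))
          (legendre_poly k))"
proof -
  let ?c = "\<lambda>l j. real ((n + 2) choose l) * real (l choose j) *
      euler_const (n - l + 1) * bernoulli_const (l - j)"
  let ?P = legendre_poly
  \<comment> \<open>Padding with zero terms makes the range of k independent of j, so that the sum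
    over k can be moved outermost.\<close>
  have mono: "[:0, 1:] ^ j = (\<Sum>k=0..n. smult ((2 * real k + 1) * monomial_coeff j k) (?P k))"
    if "j \<le> n" for j
    unfolding monomial_legendre using that
    by (intro sum.mono_neutral_left) (auto simp: monomial_coeff_eq_0)
  have inner: "(\<Sum>j | j \<le> l \<and> [int j - int k = 0] (mod 2). ?c l j *
        (fact j * fact ((j + k + 2) div 2) * inv_fact ((int j - int k) div 2) / fact (j + k + 2)))
      = (\<Sum>j\<le>l. ?c l j * (monomial_coeff j k / 2 ^ (k + 1)))" for l k
  proof (rule sum.mono_neutral_cong_left)
    have *: "[int j - int k = 0] (mod 2) \<longleftrightarrow> even (j + k)" for j
      by (simp add: cong_0_iff)
    show "\<forall>j\<in>{..l} - {j. j \<le> l \<and> [int j - int k = 0] (mod 2)}. ?c l j * (monomial_coeff j k / 2 ^ (k + 1)) = 0"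
      by (auto simp: * monomial_coeff_def)
    show "?c l j * (fact j * fact ((j + k + 2) div 2) * inv_fact ((int j - int k) div 2) / fact (j + k + 2))
        = ?c l j * (monomial_coeff j k / 2 ^ (k + 1))"
      if "j \<in> {j. j \<le> l \<and> [int j - int k = 0] (mod 2)}" for j
      using that by (simp add: * monomial_coeff_def)
  qed auto
  have "(\<Sum>k=0..n. euler_poly k * euler_poly (n - k)) = bernoulli_side n"
    using euler_conv_eq_bernoulli_side[of n] by (simp add: euler_conv_def atMost_atLeast0)
  also have "\<dots> = smult (- 4 / (real n + 2)) (\<Sum>l=0..n. \<Sum>j\<le>l. smult (?c l j) ([:0, 1:] ^ j))"
    unfolding bernoulli_side_def bernoulli_poly_appell bernoulli_const_def atMost_atLeast0
    by (subst appell_expansion) (simp add: smult_sum_right mult_ac atMost_atLeast0)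
  also have "(\<Sum>l=0..n. \<Sum>j\<le>l. smult (?c l j) ([:0, 1:] ^ j)) =
      (\<Sum>l=0..n. \<Sum>j\<le>l. \<Sum>k=0..n. smult (?c l j * ((2 * real k + 1) * monomial_coeff j k)) (?P k))"
    by (intro sum.cong refl) (simp add: mono smult_sum_right)
  also have "\<dots> = (\<Sum>l=0..n. \<Sum>k=0..n. \<Sum>j\<le>l. smult (?c l j * ((2 * real k + 1) * monomial_coeff j k)) (?P k))"
    by (rule sum.cong[OF refl]) (rule sum.swap)
  also have "\<dots> = (\<Sum>k=0..n. \<Sum>l=0..n. \<Sum>j\<le>l. smult (?c l j * ((2 * real k + 1) * monomial_coeff j k)) (?P k))"
    by (rule sum.swap)
  \<comment> \<open>Here 2k + 1 = 2 (2^{k+1} k + 2^k) / 2^{k+1}; the extra 2 turns -4 into -8, and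
    the denominator removes the power of 2 in \<open>monomial_coeff\<close>.\<close>
  also have "\<dots> = (\<Sum>k=0..n. smult 2 (smult ((2 ^ (k + 1) * real k + 2 ^ k) *
      (\<Sum>l=0..n. \<Sum>j\<le>l. ?c l j * (monomial_coeff j k / 2 ^ (k + 1)))) (?P k)))"
    unfolding smult_sum[symmetric] smult_smult sum_distrib_left
    by (intro sum.cong refl arg_cong2[where f = smult]) (simp add: field_simps)
  finally show ?thesis
    unfolding inner smult_sum_right[symmetric] by simp
qed

end
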